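(* The only solutions of the Diophantine equation $$F_1^2+2F_2^2+\cdots+kF_k^2=F_n^2$$ in positive integers $k$ and $n$ are the trivial solutions $(k,n)=(1,1)$ and $(k,n)=(1,2)$.
   Context: $(F_n)_{n\ge 0}$ is the Fibonacci sequence: $F_0=0$, $F_1=1$, $F_{n+2}=F_{n+1}+F_n$ for all $n\ge 0$. The left-hand side of the equation is $\sum_{j=1}^k jF_j^2$. For fixed positive integers $p,q$, the trivial solutions of $\sum_{j=1}^k jF_j^p=F_n^q$ in positive integers $k,n$ are those coming from $F_1^p=1=F_1^q=F_2^q$, i.e. $(k,n)=(1,1),(1,2)$, and from $F_1^p+2F_2^p=3=F_4$, i.e. $(k,n)=(2,4)$ when $q=1$. *)

theory Defs
  imports "HOL-Number_Theory.Number_Theory"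
begin

end

theory Submission
  imports Defs
begin

text \<open>
  Write \<open>S k\<close> for the left-hand side and \<open>e\<close> for the parity of \<open>k\<close>, that is, 1 if \<open>k\<close> is odd and
  0 otherwise.  Summation by parts and Cassini's identity give the closed form
  \<open>S k = k F\<^sub>k F\<^sub>k\<^sub>+\<^sub>1 - F\<^sub>k\<^sup>2 + e\<close>, so that \<open>S k\<close> is congruent to \<open>e\<close> modulo \<open>F\<^sub>k\<close> and
  is at most \<open>k F\<^sub>k F\<^sub>k\<^sub>+\<^sub>1\<close> for \<open>k \<ge> 1\<close>.  For \<open>k \<ge> 2\<close> its last summand alone exceeds \<open>F\<^sub>k\<^sup>2\<close>.

  Suppose that \<open>S k = F\<^sub>n\<^sup>2\<close> with \<open>k \<ge> 2\<close>.  The lower bound forces \<open>n = k + m\<close> with \<open>m \<ge> 1\<close>, and the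
  addition formula \<open>F\<^sub>n = F\<^sub>m F\<^sub>k\<^sub>+\<^sub>1 + F\<^sub>m\<^sub>-\<^sub>1 F\<^sub>k\<close> shows two things about \<open>F\<^sub>m\<close>.
  It is small: \<open>F\<^sub>m\<^sup>2 F\<^sub>k\<^sub>+\<^sub>1\<^sup>2 \<le> F\<^sub>n\<^sup>2 \<le> k F\<^sub>k F\<^sub>k\<^sub>+\<^sub>1\<close>, hence \<open>F\<^sub>m\<^sup>2 \<le> k\<close>
  (\<open>fib_offset_bound\<close>).  And since \<open>F\<^sub>k\<^sub>+\<^sub>1\<^sup>2\<close> is congruent to \<open>(-1)\<^sup>k\<close> modulo \<open>F\<^sub>k\<close>, the equation
  reduces modulo \<open>F\<^sub>k\<close> to \<open>F\<^sub>k dvd F\<^sub>m\<^sup>2 + e\<close> (\<open>fib_dvd_offset\<close>).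
  So the exponentially large \<open>F\<^sub>k\<close> divides a positive number that is at most \<open>k + 1\<close>, which is
  impossible once \<open>k \<ge> 6\<close>.  For \<open>k = 2, 3, 4, 5\<close> the values 3, 15, 51, 176 of \<open>S k\<close> are not squares.
\<close>

text \<open>Cassini's identity as a quadratic relation between two consecutive Fibonacci numbers; it is
  both the step from \<open>k\<close> to \<open>k + 1\<close> in the closed form and the value of \<open>F\<^sub>k\<^sub>+\<^sub>1\<^sup>2\<close> modulo \<open>F\<^sub>k\<close>.\<close>

lemma fib_Suc_square:
  "(int (fib (Suc k)))\<^sup>2 = (int (fib k))\<^sup>2 + int (fib k) * int (fib (Suc k)) + (-1) ^ k"
  using fib_Cassini_int[of k] by (simp add: power2_eq_square algebra_simps)

text \<open>Stated with \<open>F\<^sub>k\<^sup>2\<close> on the left, so that no subtraction occurs.\<close>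

lemma weighted_sum_fib_squares:
  "(\<Sum>j=1..k. j * fib j ^ 2) + fib k ^ 2 = k * fib k * fib (Suc k) + of_bool (odd k)"
proof -
  have "int (\<Sum>j=1..k. j * fib j ^ 2) + (int (fib k))\<^sup>2 =
    int k * int (fib k) * int (fib (Suc k)) + of_bool (odd k)"
  proof (induction k)
    case 0
    then show ?case by simp
  next
    case (Suc k)
    \<comment> \<open>Cassini's sign is the change of parity from \<open>k\<close> to \<open>k + 1\<close>.\<close>
    have "(-1 :: int) ^ k = of_bool (odd (Suc k)) - of_bool (odd k)"
      by (cases "even k") simp_all
    with Suc fib_Suc_square[of k] show ?case
      by (simp add: algebra_simps power2_eq_square)
  qed
  then show ?thesis
    by (intro of_nat_eq_iff[where 'a = int, THEN iffD1]) simp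
qed

lemma fib_small:
  "fib 3 = 2" "fib 4 = 3" "fib 5 = 5" "fib 6 = 8"
  by (simp_all add: numeral_eq_Suc)

lemma less_fib:
  assumes "k \<ge> 6"
  shows "k + 1 < fib k"
  using assms
proof (induction k rule: dec_induct)
  case base
  show ?case by (simp add: fib_small)
next
  case (step k)
  then obtain i where "k = Suc i" by (cases k) auto
  moreover have "fib i > 0"
    using step \<open>k = Suc i\<close> by (intro fib_neq_0_nat) simp
  ultimately show ?case using step by simp
qed

text \<open>With \<open>n = Suc (l + k)\<close> and \<open>m = Suc l\<close>, the addition formula gives \<open>F\<^sub>m F\<^sub>k\<^sub>+\<^sub>1 \<le> F\<^sub>n\<close>, while the
  sum is at most \<open>k F\<^sub>k F\<^sub>k\<^sub>+\<^sub>1 \<le> k F\<^sub>k\<^sub>+\<^sub>1\<^sup>2\<close>; cancel \<open>F\<^sub>k\<^sub>+\<^sub>1\<^sup>2\<close>.\<close>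

lemma fib_offset_bound:
  assumes eq: "(\<Sum>j=1..k. j * fib j ^ 2) = fib (Suc (l + k)) ^ 2" and "k > 0"
  shows "fib (Suc l) ^ 2 \<le> k"
proof -
  have pos: "fib k > 0" "fib (Suc k) > 0"
    using \<open>k > 0\<close> by (auto intro: fib_neq_0_nat)
  have "(fib (Suc l) * fib (Suc k))\<^sup>2 \<le> fib (Suc (l + k)) ^ 2"
    by (intro power_mono) (simp_all add: fib_add mult.commute)
  also have "\<dots> \<le> k * fib k * fib (Suc k)"
  proof -
    have "of_bool (odd k) \<le> fib k ^ 2"
      using pos by (simp add: Suc_le_eq)
    then show ?thesis
      using weighted_sum_fib_squares[of k] unfolding eq by linarith
  qed
  also have "\<dots> \<le> k * (fib (Suc k))\<^sup>2"
    by (simp add: power2_eq_square fib_Suc_mono)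
  finally show ?thesis
    using pos by (simp add: power_mult_distrib)
qed

text \<open>Modulo \<open>F\<^sub>k\<close> the equation reads \<open>e \<equiv> (-1)\<^sup>k F\<^sub>m\<^sup>2\<close>, by the addition formula and Cassini.
  Multiplying by \<open>(-1)\<^sup>k\<close> turns \<open>e\<close> into \<open>-e\<close>, because \<open>e\<close> vanishes for even \<open>k\<close>; this gives one
  divisibility, of a positive number, for both parities.\<close>

lemma fib_dvd_offset:
  assumes eq: "(\<Sum>j=1..k. j * fib j ^ 2) = fib (Suc (l + k)) ^ 2"
  shows "fib k dvd fib (Suc l) ^ 2 + of_bool (odd k)"
proof -
  define a b c d where "a = int (fib k)" and "b = int (fib (Suc k))"
    and "c = int (fib l)" and "d = int (fib (Suc l))"
  define s :: int where "s = (-1) ^ k"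
  define e :: int where "e = of_bool (odd k)"
  have s: "s * s = 1" "s * e = - e"
    by (cases "even k"; simp add: s_def e_def)+
  have b: "b\<^sup>2 = a\<^sup>2 + a * b + s"
    unfolding a_def b_def s_def by (rule fib_Suc_square)
  have "(\<Sum>j=1..k. j * fib j ^ 2) = (fib (Suc k) * fib (Suc l) + fib k * fib l)\<^sup>2"
    unfolding eq by (simp add: fib_add algebra_simps)
  then have "(b * d + a * c)\<^sup>2 + a\<^sup>2 = int k * a * b + e"
    using arg_cong[OF weighted_sum_fib_squares[of k], of int]
    by (simp add: a_def b_def c_def d_def e_def)
  \<comment> \<open>The cofactor is what remains after expanding the square and replacing \<open>b\<^sup>2\<close>.\<close>
  then have "s * d\<^sup>2 - e = a * (int k * b - a - 2 * b * c * d - a * c\<^sup>2 - (a + b) * d\<^sup>2)"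
    using arg_cong[OF b, of "\<lambda>x. x * d\<^sup>2"] by (simp add: power2_eq_square algebra_simps)
  then have "a dvd s * (s * d\<^sup>2 - e)"
    by simp
  also have "s * (s * d\<^sup>2 - e) = d\<^sup>2 + e"
    using s by (simp add: right_diff_distrib flip: mult.assoc)
  also have "\<dots> = int (fib (Suc l) ^ 2 + of_bool (odd k))"
    by (simp add: d_def e_def)
  finally show ?thesis
    unfolding a_def by (simp only: of_nat_dvd_iff)
qed

lemma not_square_between:
  fixes x a :: nat
  assumes "a\<^sup>2 < x\<^sup>2" and "x\<^sup>2 < (a + 1)\<^sup>2"
  shows False
  using assms power_less_imp_less_base[of a 2 x] power_less_imp_less_base[of x 2 "a + 1"] by simp

lemma weighted_sum_fib_squares_ne_fib_square:
  assumes "k \<ge> 2"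
  shows "(\<Sum>j=1..k. j * fib j ^ 2) \<noteq> fib n ^ 2"
proof
  assume eq: "(\<Sum>j=1..k. j * fib j ^ 2) = fib n ^ 2"
  show False
  proof (cases "k \<ge> 6")
    case True
    have pos: "fib k > 0"
      using \<open>k \<ge> 2\<close> by (intro fib_neq_0_nat) simp
    have "fib k ^ 2 < k * fib k ^ 2"
      using pos \<open>k \<ge> 2\<close> by simp
    also have "\<dots> \<le> fib n ^ 2"
      unfolding eq[symmetric] using \<open>k \<ge> 2\<close> by (intro member_le_sum) auto
    finally have "fib k < fib n"
      by (rule power_less_imp_less_base) simp
    then have "k < n"
      using fib_mono[of n k] by (meson not_le)
    then obtain l where "n = Suc (l + k)"
      by (metis less_iff_Suc_add add.commute)
    note eq = eq[unfolded this]
    have "fib k \<le> fib (Suc l) ^ 2 + of_bool (odd k)"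
      using fib_dvd_offset[OF eq] by (rule dvd_imp_le) (simp add: fib_neq_0_nat)
    also have "\<dots> \<le> k + 1"
      using fib_offset_bound[OF eq] True by simp
    finally show False
      using less_fib[OF True] by simp
  next
    case False
    with \<open>k \<ge> 2\<close> consider "k = 2" | "k = 3" | "k = 4" | "k = 5"
      by linarith
    then show False
    proof cases
      case 1
      then have "fib n ^ 2 = 3"
        using weighted_sum_fib_squares[of k, unfolded eq] by (simp add: fib_small)
      then show False
        using not_square_between[of 1 "fib n"] by (simp del: One_nat_def)
    next
      case 2
      then have "fib n ^ 2 = 15"
        using weighted_sum_fib_squares[of k, unfolded eq] by (simp add: fib_small)
      then show False
        using not_square_between[of 3 "fib n"] by (simp del: One_nat_def)
    next
      case 3
      then have "fib n ^ 2 = 51"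
        using weighted_sum_fib_squares[of k, unfolded eq] by (simp add: fib_small)
      then show False
        using not_square_between[of 7 "fib n"] by (simp del: One_nat_def)
    next
      case 4
      then have "fib n ^ 2 = 176"
        using weighted_sum_fib_squares[of k, unfolded eq] by (simp add: fib_small)
      then show False
        using not_square_between[of 13 "fib n"] by (simp del: One_nat_def)
    qed
  qed
qed

lemma fib_eq_1_iff: "fib n = 1 \<longleftrightarrow> n = 1 \<or> n = 2"
proof
  assume one: "fib n = 1"
  then have "n \<noteq> 0"
    by (intro notI) simp
  moreover have "\<not> n \<ge> 3"
    using fib_mono[of 3 n] one by (auto simp: fib_small)
  ultimately show "n = 1 \<or> n = 2" by linarith
qed auto

theorem theorem2:
  fixes k n :: nat
  assumes "k \<ge> 1" and "n \<ge> 1"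
  shows "(\<Sum>j=1..k. j * fib j ^ 2) = fib n ^ 2 \<longleftrightarrow> (k, n) = (1, 1) \<or> (k, n) = (1, 2)"
proof (cases "k = 1")
  case True
  then show ?thesis
    using fib_eq_1_iff[of n] eq_commute[of 1 "fib n ^ 2"] by simp
next
  case False
  then show ?thesis
    using assms weighted_sum_fib_squares_ne_fib_square[of k n] by simp
qed

end
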